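(* For each $g=(t,z_0,c_0)\in G$, the kernel of $\pi(g)$ is $$k_{\pi(g)}(z,w)=\chi(t)e^{i\lambda c_0}\exp\left(\tfrac\lambda2\bar z_0z+\tfrac\lambda2\bar w\,(t^{-1}\cdot(z-z_0))-\tfrac\lambda4|z_0|^2\right),\qquad z,w\in\mathbb C^n.$$ Consequently, $$S_\lambda(\pi(g))(z)=\chi(t)e^{i\lambda c_0}\exp\left(\tfrac\lambda2\bar z_0z+\tfrac\lambda2\bar z\,(t^{-1}\cdot(z-z_0))-\tfrac\lambda2|z|^2-\tfrac\lambda4|z_0|^2\right)$$ for each $z\in\mathbb C^n$.
   Context: Fix integers $n,m\ge 1$ and $\lambda>0$. For $z,w\in\mathbb C^n$ put $zw:=\sum_k z_kw_k$ (bilinear), $|z|^2=z\bar z$, and $\omega((z,w),(z',w')):=\tfrac i2(zw'-z'w)$. Let $\alpha_1,\dots,\alpha_n$ be linear forms on $\mathbb R^m$; $t\cdot z=(e^{i\alpha_1(t)}z_1,\dots,e^{i\alpha_n(t)}z_n)$ for $t\in\mathbb R^m$; $t^{-1}$ means $-t$. The generalized diamond group $G$ is $\mathbb R^m\times\mathbb C^n\times\mathbb R$ with $(t,z,c)\cdot(t',z',c')=(t+t',\,z+t\cdot z',\,c+c'+\tfrac12\omega((z,\bar z),(t\cdot z',\overline{t\cdot z'})))$. $\mathcal F_\lambda$ is the Hilbert space of holomorphic $f$ on $\mathbb C^n$ with $\int_{\mathbb C^n}|f(z)|^2e^{-\lambda|z|^2/2}d\mu_\lambda(z)<\infty$, $d\mu_\lambda=(2\pi)^{-n}\lambda^n\,dx\,dy$,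 $z=x+iy$. Fix a unitary character $\chi$ of $\mathbb R^m$; the unitary representation $\pi$ of $G$ on $\mathcal F_\lambda$ is $(\pi(t,z_0,c_0)f)(z)=\chi(t)\exp(i\lambda c_0+\tfrac\lambda2\bar z_0z-\tfrac\lambda4|z_0|^2)f(t^{-1}\cdot(z-z_0))$. Coherent states: $e_z(w)=\exp(\lambda\bar zw/2)$, so $f(z)=\langle f,e_z\rangle$. The kernel of an operator $A$ is $k_A(z,w)=\langle Ae_w,e_z\rangle$, and its Berezin symbol is $S_\lambda(A)(z)=\langle Ae_z,e_z\rangle/\langle e_z,e_z\rangle$. *)

theory Defs
  imports "HOL-Analysis.Analysis" "HOL-Algebra.Group"
begin

text \<open>
  \<^typ>\<open>complex ^ 'n\<close> plays the role of the complex \<open>n\<close>-space with \<open>n = CARD('n)\<close>, and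
  \<^typ>\<open>real ^ 'm\<close> that of the real \<open>m\<close>-space; \<open>*s\<close> is multiplication by complex scalars, while
  \<open>norm\<close>, the derivative and \<^const>\<open>lborel\<close> refer to the underlying real Euclidean space of
  dimension \<open>2 n\<close>.
\<close>

definition bil :: "complex ^ 'n \<Rightarrow> complex ^ 'n \<Rightarrow> complex" where
  "bil z w = (\<Sum>k\<in>UNIV. z $ k * w $ k)"

definition vcnj :: "complex ^ 'n \<Rightarrow> complex ^ 'n" where
  "vcnj z = (\<chi> k. cnj (z $ k))"

lemma bil_vcnj_self: "bil z (vcnj z) = of_real ((norm z)\<^sup>2)"
proof -
  have "(norm z)\<^sup>2 = (\<Sum>k\<in>UNIV. (norm (z $ k))\<^sup>2)"
    by (simp add: norm_vec_def L2_set_def sum_nonneg)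
  then show ?thesis
    by (simp add: bil_def vcnj_def complex_norm_square del: of_real_power)
qed

definition omega :: "(complex ^ 'n) \<times> (complex ^ 'n) \<Rightarrow> (complex ^ 'n) \<times> (complex ^ 'n) \<Rightarrow> complex" where
  "omega = (\<lambda>(z, w) (z', w'). \<i> / 2 * (bil z w' - bil z' w))"

definition torus_act :: "('n \<Rightarrow> real ^ 'm \<Rightarrow> real) \<Rightarrow> real ^ 'm \<Rightarrow> complex ^ 'n \<Rightarrow> complex ^ 'n" where
  "torus_act \<alpha> t z = (\<chi> k. exp (\<i> * of_real (\<alpha> k t)) * z $ k)"

text \<open>
  On pairs \<open>(z, vcnj z)\<close> the form \<^const>\<open>omega\<close> is real valued (see \<open>omega_vcnj\<close>), so taking
  \<^const>\<open>Re\<close> in the group law loses nothing.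
\<close>

definition diamond_mult ::
    "('n \<Rightarrow> real ^ 'm \<Rightarrow> real) \<Rightarrow> (real ^ 'm) \<times> (complex ^ 'n) \<times> real
      \<Rightarrow> (real ^ 'm) \<times> (complex ^ 'n) \<times> real \<Rightarrow> (real ^ 'm) \<times> (complex ^ 'n) \<times> real" where
  "diamond_mult \<alpha> = (\<lambda>(t, z, c) (t', z', c').
     (t + t', z + torus_act \<alpha> t z',
      c + c' + Re (omega (z, vcnj z) (torus_act \<alpha> t z', vcnj (torus_act \<alpha> t z'))) / 2))"

definition diamond_group ::
    "('n \<Rightarrow> real ^ 'm \<Rightarrow> real) \<Rightarrow> ((real ^ 'm) \<times> (complex ^ 'n) \<times> real) monoid" where
  "diamond_group \<alpha> = \<lparr>carrier = UNIV, mult = diamond_mult \<alpha>, one = (0, 0, 0)\<rparr>"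

lemma omega_vcnj: "omega (z, vcnj z) (w, vcnj w) = of_real (- Im (bil z (vcnj w)))"
proof -
  have "bil w (vcnj z) = cnj (bil z (vcnj w))"
    by (simp add: bil_def vcnj_def mult.commute)
  then show ?thesis
    by (simp add: omega_def complex_eq_iff)
qed

lemma group_diamond_group:
  assumes "\<And>k. linear (\<alpha> k)"
  shows "group (diamond_group \<alpha>)"
proof -
  have act_add: "torus_act \<alpha> (s + t) z = torus_act \<alpha> s (torus_act \<alpha> t z)" for s t z
    using assms by (simp add: torus_act_def linear_add distrib_left exp_add vec_eq_iff)
  have act_0: "torus_act \<alpha> 0 z = z" for z
    using assms by (simp add: torus_act_def linear_0 vec_eq_iff)
  have act_plus: "torus_act \<alpha> t (z + w) = torus_act \<alpha> t z + torus_act \<alpha> t w" for t z w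
    by (simp add: torus_act_def distrib_left vec_eq_iff)
  have act_uminus: "torus_act \<alpha> t (- z) = - torus_act \<alpha> t z" for t z
    by (simp add: torus_act_def vec_eq_iff)
  have act_zero: "torus_act \<alpha> t 0 = 0" for t
    by (simp add: torus_act_def vec_eq_iff)
  have bil_act: "bil (torus_act \<alpha> t z) (vcnj (torus_act \<alpha> t w)) = bil z (vcnj w)" for t z w
  proof -
    have "(exp (\<i> * complex_of_real x) * a) * (cnj (exp (\<i> * complex_of_real x)) * b) = a * b" for x a b
    proof -
      have "exp (\<i> * complex_of_real x) * cnj (exp (\<i> * complex_of_real x)) = 1"
        by (metis cis_conv_exp cis_cnj cis_mult add.right_inverse cis_zero)
      then show ?thesis by (metis (no_types, lifting) mult.assoc mult.left_commute mult_1)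
    qed
    then show ?thesis
      unfolding torus_act_def bil_def vcnj_def by (simp only: vec_lambda_beta complex_cnj_mult)
  qed
  have bil_l: "bil (z + z') w = bil z w + bil z' w" for z z' w :: "complex ^ 'n"
    by (simp add: bil_def distrib_right sum.distrib)
  have bil_r: "bil z (vcnj (w + w')) = bil z (vcnj w) + bil z (vcnj w')" for z w w' :: "complex ^ 'n"
    by (simp add: bil_def vcnj_def distrib_left sum.distrib)
  have bil_um: "bil (- z) w = - bil z w" for z w :: "complex ^ 'n"
    by (simp add: bil_def sum_negf)
  have bil_00: "bil 0 w = 0" "bil w (vcnj 0) = 0" for w :: "complex ^ 'n"
    by (simp_all add: bil_def vcnj_def)
  show ?thesis
  proof (rule groupI)
    fix x y z :: "(real ^ 'b) \<times> (complex ^ 'a) \<times> real"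
    show "x \<otimes>\<^bsub>diamond_group \<alpha>\<^esub> y \<otimes>\<^bsub>diamond_group \<alpha>\<^esub> z
        = x \<otimes>\<^bsub>diamond_group \<alpha>\<^esub> (y \<otimes>\<^bsub>diamond_group \<alpha>\<^esub> z)"
      by (cases x; cases y; cases z)
         (simp add: diamond_group_def diamond_mult_def omega_vcnj act_add act_plus bil_l bil_r
            bil_act algebra_simps add_divide_distrib)
  next
    fix x :: "(real ^ 'b) \<times> (complex ^ 'a) \<times> real"
    obtain t z c where x: "x = (t, z, c)" by (cases x)
    have "(- t, - torus_act \<alpha> (- t) z, - c) \<otimes>\<^bsub>diamond_group \<alpha>\<^esub> x = \<one>\<^bsub>diamond_group \<alpha>\<^esub>"
      by (simp add: x diamond_group_def diamond_mult_def omega_vcnj bil_um bil_act bil_vcnj_self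
            del: of_real_power)
    then show "\<exists>y\<in>carrier (diamond_group \<alpha>). y \<otimes>\<^bsub>diamond_group \<alpha>\<^esub> x = \<one>\<^bsub>diamond_group \<alpha>\<^esub>"
      unfolding diamond_group_def by auto
  qed (auto simp: diamond_group_def diamond_mult_def omega_vcnj act_0 bil_00)
qed

definition unitary_character :: "(real ^ 'm \<Rightarrow> complex) \<Rightarrow> bool" where
  "unitary_character chi \<longleftrightarrow>
     continuous_on UNIV chi \<and> (\<forall>t. norm (chi t) = 1) \<and> (\<forall>s t. chi (s + t) = chi s * chi t)"

text \<open>Holomorphy in several variables: the real total derivative exists and is complex linear.\<close>

definition entire_on_Cn :: "(complex ^ 'n \<Rightarrow> complex) \<Rightarrow> bool" where
  "entire_on_Cn f \<longleftrightarrow>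
     (\<forall>z. \<exists>D. (f has_derivative D) (at z) \<and> (\<forall>c v. D (c *s v) = c * D v))"

definition fock_measure :: "real \<Rightarrow> (complex ^ 'n) measure" where
  "fock_measure lam =
     density lborel (\<lambda>_. ennreal (lam ^ CARD('n) / (2 * pi) ^ CARD('n)))"

definition fock_space :: "real \<Rightarrow> (complex ^ 'n \<Rightarrow> complex) set" where
  "fock_space lam =
     {f. entire_on_Cn f \<and>
         integrable (fock_measure lam) (\<lambda>z. (norm (f z))\<^sup>2 * exp (- lam * (norm z)\<^sup>2 / 2))}"

definition fock_inner :: "real \<Rightarrow> (complex ^ 'n \<Rightarrow> complex) \<Rightarrow> (complex ^ 'n \<Rightarrow> complex) \<Rightarrow> complex" where
  "fock_inner lam f g =
     (\<integral>z. f z * cnj (g z) * of_real (exp (- lam * (norm z)\<^sup>2 / 2)) \<partial>fock_measure lam)"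

text \<open>
  Operators on the Fock space are functions restricted to \<^const>\<open>fock_space\<close>: outside of it
  \<open>fock_rep\<close> is \<^const>\<open>undefined\<close>.
\<close>

definition fock_rep ::
    "real \<Rightarrow> ('n \<Rightarrow> real ^ 'm \<Rightarrow> real) \<Rightarrow> (real ^ 'm \<Rightarrow> complex) \<Rightarrow> (real ^ 'm) \<times> (complex ^ 'n) \<times> real
      \<Rightarrow> (complex ^ 'n \<Rightarrow> complex) \<Rightarrow> (complex ^ 'n \<Rightarrow> complex)" where
  "fock_rep lam \<alpha> chi = (\<lambda>(t, z0, c0). \<lambda>f\<in>fock_space lam. \<lambda>z.
     chi t * exp (\<i> * of_real lam * of_real c0 + of_real lam / 2 * bil (vcnj z0) z
                - of_real lam / 4 * of_real ((norm z0)\<^sup>2))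
         * f (torus_act \<alpha> (- t) (z - z0)))"

definition coherent :: "real \<Rightarrow> complex ^ 'n \<Rightarrow> complex ^ 'n \<Rightarrow> complex" where
  "coherent lam z = (\<lambda>w. exp (of_real lam * bil (vcnj z) w / 2))"

definition op_kernel ::
    "real \<Rightarrow> ((complex ^ 'n \<Rightarrow> complex) \<Rightarrow> (complex ^ 'n \<Rightarrow> complex))
      \<Rightarrow> complex ^ 'n \<Rightarrow> complex ^ 'n \<Rightarrow> complex" where
  "op_kernel lam A z w = fock_inner lam (A (coherent lam w)) (coherent lam z)"

definition berezin_symbol ::
    "real \<Rightarrow> ((complex ^ 'n \<Rightarrow> complex) \<Rightarrow> (complex ^ 'n \<Rightarrow> complex)) \<Rightarrow> complex ^ 'n \<Rightarrow> complex" where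
  "berezin_symbol lam A z =
     fock_inner lam (A (coherent lam z)) (coherent lam z)
       / fock_inner lam (coherent lam z) (coherent lam z)"

end

theory Submission
  imports Defs "HOL-Probability.Characteristic_Functions"
begin

text \<open>
  The operator \<open>\<pi>(t, z\<^sub>0, c\<^sub>0)\<close> maps the coherent state at \<open>w\<close> to a scalar multiple of the coherent
  state at \<open>z\<^sub>0 + t \<cdot> w\<close>, so everything reduces to the inner product of two coherent states. That
  inner product is the integral of the exponential of a complex-valued real-linear functional
  against a Gaussian; by Fubini it splits into one-dimensional integrals, each of which is
  the characteristic function of the normal distribution after completing the square.
\<close>

section \<open>Gaussian integrals with complex linear exponent\<close>

lemma has_bochner_integral_gaussian_real:
  fixes c :: complex and s :: real
  assumes "s > 0"
  shows "has_bochner_integral lborel (\<lambda>x::real. exp (c * of_real x - of_real (s * x\<^sup>2)))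
           (of_real (sqrt (pi / s)) * exp (c\<^sup>2 / of_real (4 * s)))"
proof -
  \<comment> \<open>Substituting \<open>p + r * x\<close> centres and rescales the Gaussian: the
    real part of the exponent becomes \<open>(Re c)\<^sup>2 / (4 * s) - x\<^sup>2 / 2\<close>. Only
    \<open>Re c\<close> enters the shift, so the line of integration stays real and no contour has
    to be moved; \<open>Im c\<close> is left to the characteristic function. \<open>K\<close>
    collects the factors of the integrand that do not depend on \<open>x\<close>.\<close>
  define r where "r = 1 / sqrt (2 * s)"
  define p where "p = Re c / (2 * s)"
  define K where "K = exp (of_real ((Re c)\<^sup>2 / (4 * s)) + \<i> * of_real (Im c * p))"
  have r: "r > 0" "r\<^sup>2 = 1 / (2 * s)"
    using assms by (simp_all add: r_def power_divide)
  interpret real_distribution std_normal_distribution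
    by (rule real_dist_normal_dist)
  have "has_bochner_integral std_normal_distribution (\<lambda>x. iexp (Im c * r * x))
          (of_real (exp (- (Im c * r)\<^sup>2 / 2)))"
    unfolding has_bochner_integral_iff
  proof
    show "integrable std_normal_distribution (\<lambda>x. iexp (Im c * r * x))"
      by (rule integrable_iexp, measurable)
    show "(CLINT x|std_normal_distribution. iexp (Im c * r * x)) = of_real (exp (- (Im c * r)\<^sup>2 / 2))"
      using char_std_normal_distribution unfolding char_def fun_eq_iff by blast
  qed
  then have "has_bochner_integral lborel (\<lambda>x. std_normal_density x *\<^sub>R iexp (Im c * r * x))
          (of_real (exp (- (Im c * r)\<^sup>2 / 2)))"
    by (simp add: has_bochner_integral_iff integrable_density integral_density)
  \<comment> \<open>The factor \<open>sqrt (2 * pi)\<close> cancels the normalisation of the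
    standard normal density.\<close>
  then have int: "has_bochner_integral lborel
      (\<lambda>x. K * of_real (sqrt (2 * pi)) * (std_normal_density x *\<^sub>R iexp (Im c * r * x)))
      (K * of_real (sqrt (2 * pi)) * (of_real (exp (- (Im c * r)\<^sup>2 / 2))))"
    by (rule has_bochner_integral_mult_right)
  have integrand: "(\<lambda>x. K * of_real (sqrt (2 * pi)) * (std_normal_density x *\<^sub>R iexp (Im c * r * x)))
      = (\<lambda>x. exp (c * of_real (p + r * x) - of_real (s * (p + r * x)\<^sup>2)))"
  proof
    fix x
    have "Re c * (p + r * x) - s * (p + r * x)\<^sup>2 = (Re c)\<^sup>2 / (4 * s) - s * r\<^sup>2 * x\<^sup>2"
      using assms by (simp add: p_def field_simps power2_eq_square)
    also have "\<dots> = (Re c)\<^sup>2 / (4 * s) - x\<^sup>2 / 2"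
      using assms by (simp add: r)
    finally have "c * of_real (p + r * x) - of_real (s * (p + r * x)\<^sup>2)
       = of_real ((Re c)\<^sup>2 / (4 * s)) + \<i> * of_real (Im c * p) + (of_real (- x\<^sup>2 / 2) + \<i> * of_real (Im c * r * x))"
      by (simp add: complex_eq_iff algebra_simps)
    then show "K * of_real (sqrt (2 * pi)) * (std_normal_density x *\<^sub>R iexp (Im c * r * x))
      = exp (c * of_real (p + r * x) - of_real (s * (p + r * x)\<^sup>2))"
      by (simp only: exp_add K_def)
         (simp add: std_normal_density_def scaleR_conv_of_real exp_of_real[symmetric])
  qed
  have "K * of_real (sqrt (2 * pi)) * (of_real (exp (- (Im c * r)\<^sup>2 / 2)))
      = of_real (sqrt (2 * pi)) * exp (c\<^sup>2 / of_real (4 * s))"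
  proof -
    have "c\<^sup>2 / of_real (4 * s)
      = of_real ((Re c)\<^sup>2 / (4 * s)) + \<i> * of_real (Im c * p) + of_real (- (Im c * r)\<^sup>2 / 2)"
      using assms by (simp add: power_mult_distrib r p_def complex_eq_iff Re_power2 Im_power2
          field_simps)
    then show ?thesis
      by (simp only: exp_add K_def exp_of_real) (simp only: mult_ac)
  qed
  \<comment> \<open>Division by the Jacobian \<open>\<bar>r\<bar>\<close> puts the value into the
    shape that the affine change of variables expects.\<close>
  also have "of_real (sqrt (2 * pi)) * exp (c\<^sup>2 / of_real (4 * s))
      = (of_real (sqrt (pi / s)) * exp (c\<^sup>2 / of_real (4 * s))) /\<^sub>R \<bar>r\<bar>"
  proof -
    have "sqrt (2 * pi) = inverse \<bar>r\<bar> * sqrt (pi / s)"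
      using assms by (simp add: r_def real_sqrt_divide real_sqrt_mult)
    then show ?thesis
      by (simp only: scaleR_conv_of_real of_real_mult mult.assoc)
  qed
  finally have "has_bochner_integral lborel (\<lambda>x. exp (c * of_real (p + r * x) - of_real (s * (p + r * x)\<^sup>2)))
      ((of_real (sqrt (pi / s)) * exp (c\<^sup>2 / of_real (4 * s))) /\<^sub>R \<bar>r\<bar>)"
    using int by (simp only: integrand)
  with r(1) show ?thesis
    by (subst lborel_has_bochner_integral_real_affine_iff[of r _ _ p]) simp_all
qed

text \<open>In orthonormal coordinates the integrand is a product of one-dimensional ones. The
  coefficients \<open>c b\<close> are arbitrary complex numbers, so the linear part need not be
  complex linear even when the space is \<open>complex ^ 'n\<close>.\<close>

lemma has_bochner_integral_gaussian:
  fixes c :: "'a::euclidean_space \<Rightarrow> complex" and s :: real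
  assumes "s > 0"
  shows "has_bochner_integral lborel
           (\<lambda>x. exp ((\<Sum>b\<in>Basis. c b * of_real (x \<bullet> b)) - of_real (s * (norm x)\<^sup>2)))
           (of_real (sqrt (pi / s) ^ DIM('a)) * exp ((\<Sum>b\<in>Basis. (c b)\<^sup>2) / of_real (4 * s)))"
proof -
  interpret product_sigma_finite "\<lambda>_::'a. lborel :: real measure" ..
  let ?g = "\<lambda>b x. exp (c b * of_real x - of_real (s * x\<^sup>2))"
  let ?P = "\<Pi>\<^sub>M b\<in>(Basis::'a set). (lborel :: real measure)"
  have g: "integrable lborel (?g b)"
    "integral\<^sup>L lborel (?g b) = of_real (sqrt (pi / s)) * exp ((c b)\<^sup>2 / of_real (4 * s))" for b
    using has_bochner_integral_gaussian_real[OF assms, of "c b"]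
    by (simp_all only: has_bochner_integral_iff)
  have "has_bochner_integral ?P (\<lambda>x. \<Prod>b\<in>Basis. ?g b (x b)) (\<Prod>b\<in>Basis. integral\<^sup>L lborel (?g b))"
    unfolding has_bochner_integral_iff
    by (intro conjI product_integrable_prod product_integral_prod finite_Basis g)
  also have "(\<Prod>b\<in>Basis. integral\<^sup>L lborel (?g b))
      = of_real (sqrt (pi / s) ^ DIM('a)) * exp ((\<Sum>b\<in>Basis. (c b)\<^sup>2) / of_real (4 * s))"
    by (simp only: g) (simp add: prod.distrib exp_sum sum_divide_distrib)
  \<comment> \<open>The outer function is composed with the coordinate map because
    \<open>lborel\<close> is the image of the product measure under that map.\<close>
  also have "(\<lambda>x. \<Prod>b\<in>Basis. ?g b (x b)) =
      (\<lambda>x. (\<lambda>x. exp ((\<Sum>b\<in>Basis. c b * of_real (x \<bullet> b)) - of_real (s * (norm x)\<^sup>2)))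
         (\<Sum>b\<in>Basis. x b *\<^sub>R b))"
  proof
    fix x :: "'a \<Rightarrow> real"
    let ?y = "\<Sum>b\<in>Basis. x b *\<^sub>R b"
    have n: "(norm ?y)\<^sup>2 = (\<Sum>b\<in>Basis. (x b)\<^sup>2)"
      unfolding power2_norm_eq_inner by (subst euclidean_inner) (simp add: power2_eq_square)
    show "(\<Prod>b\<in>Basis. ?g b (x b)) = (\<lambda>x. exp ((\<Sum>b\<in>Basis. c b * of_real (x \<bullet> b)) - of_real (s * (norm x)\<^sup>2))) ?y"
      by (simp only: n) (simp add: exp_sum[symmetric] sum_subtractf sum_distrib_left)
  qed
  finally show ?thesis
    by (subst lborel_eq, intro has_bochner_integral_distr) simp_all
qed

section \<open>Inner products of coherent states\<close>

text \<open>Pairs the two real directions belonging to one complex coordinate, so that their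
  contributions to the Gaussian exponent can be combined.\<close>

lemma sum_Basis_complex_vec:
  fixes h :: "complex ^ 'n \<Rightarrow> 'a::comm_monoid_add"
  shows "(\<Sum>b\<in>Basis. h b) = (\<Sum>k\<in>UNIV. h (axis k 1) + h (axis k \<i>))"
proof -
  let ?axis = "\<lambda>(k, u). axis k u :: complex ^ 'n"
  have "inj_on ?axis (UNIV \<times> Basis)"
    by (auto simp: inj_on_def axis_eq_axis)
  moreover have "Basis = ?axis ` (UNIV \<times> Basis)"
    by (auto simp: Basis_vec_def)
  ultimately have "(\<Sum>b\<in>Basis. h b) = (\<Sum>p\<in>UNIV \<times> Basis. h (?axis p))"
    using sum.reindex[of ?axis "UNIV \<times> Basis" h] by simp
  also have "\<dots> = (\<Sum>k\<in>UNIV. \<Sum>u\<in>Basis. h (axis k u))"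
    by (simp add: sum.cartesian_product case_prod_unfold)
  finally show ?thesis
    by (simp add: Basis_complex_def)
qed

lemma entire_coherent: "entire_on_Cn (coherent lam a)"
  unfolding entire_on_Cn_def
proof (intro allI exI conjI)
  fix z c v
  have "linear (bil (vcnj a))"
    by (rule linearI) (simp_all add: bil_def sum.distrib distrib_left scaleR_sum_right)
  then have "(bil (vcnj a) has_derivative bil (vcnj a)) (at z)"
    by (simp add: linear_conv_bounded_linear bounded_linear_imp_has_derivative)
  then have "((\<lambda>w. of_real lam / 2 * bil (vcnj a) w) has_derivative (\<lambda>v. of_real lam / 2 * bil (vcnj a) v)) (at z)"
    by (rule has_derivative_mult_right)
  from has_derivative_compose[OF this DERIV_exp[unfolded has_field_derivative_def]]
  show "(coherent lam a has_derivative
      (\<lambda>v. exp (of_real lam * bil (vcnj a) z / 2) * (of_real lam * bil (vcnj a) v / 2))) (at z)"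
    by (simp add: coherent_def mult.commute)
  show "exp (of_real lam * bil (vcnj a) z / 2) * (of_real lam * bil (vcnj a) (c *s v) / 2)
      = c * (exp (of_real lam * bil (vcnj a) z / 2) * (of_real lam * bil (vcnj a) v / 2))"
    by (simp add: bil_def sum_distrib_left mult_ac)
qed

text \<open>Integrability and value are proved together: the diagonal case \<open>a = b\<close>
  gives membership in \<open>fock_space\<close>, the general case the inner product.\<close>

lemma has_bochner_integral_coherent:
  fixes a b :: "complex ^ 'n"
  assumes "lam > 0"
  shows "has_bochner_integral (fock_measure lam)
           (\<lambda>z. coherent lam a z * cnj (coherent lam b z) * of_real (exp (- lam * (norm z)\<^sup>2 / 2)))
           (exp (of_real lam * bil (vcnj a) b / 2))"
proof -
  \<comment> \<open>\<open>exp (L z)\<close> is the product of the two coherent states. As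
    \<open>z\<close> and its conjugate both occur, \<open>L\<close> is only real linear; its values
    on \<open>Basis\<close> are the coefficients for the Gaussian integral. \<open>C\<close> is the
    constant density of \<open>fock_measure\<close>.\<close>
  define L where "L v = of_real lam / 2 * (bil (vcnj a) v + bil b (vcnj v))" for v
  define C where "C = lam ^ CARD('n) / (2 * pi) ^ CARD('n)"
  let ?f = "\<lambda>z. coherent lam a z * cnj (coherent lam b z) * of_real (exp (- lam * (norm z)\<^sup>2 / 2))"
  have "linear L"
  proof (rule linearI)
    fix v w r
    show "L (v + w) = L v + L w"
      by (simp add: L_def bil_def vcnj_def sum.distrib distrib_left)
    have "bil (vcnj a) (r *\<^sub>R v) = r *\<^sub>R bil (vcnj a) v"
      "bil b (vcnj (r *\<^sub>R v)) = r *\<^sub>R bil b (vcnj v)"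
      by (simp_all add: bil_def vcnj_def scaleR_sum_right)
    then show "L (r *\<^sub>R v) = r *\<^sub>R L v"
      by (simp only: L_def scaleR_right_distrib[symmetric] mult_scaleR_right)
  qed
  then have L_eq: "(\<Sum>v\<in>Basis. L v * of_real (z \<bullet> v)) = L z" for z
  proof -
    have "L (\<Sum>v\<in>Basis. (z \<bullet> v) *\<^sub>R v) = (\<Sum>v\<in>Basis. (z \<bullet> v) *\<^sub>R L v)"
      using \<open>linear L\<close> by (simp only: linear_sum linear_scale)
    also have "\<dots> = (\<Sum>v\<in>Basis. L v * of_real (z \<bullet> v))"
      by (simp only: scaleR_conv_of_real[where 'a = complex] mult.commute)
    finally have "(\<Sum>v\<in>Basis. L v * of_real (z \<bullet> v)) = L (\<Sum>v\<in>Basis. (z \<bullet> v) *\<^sub>R v)"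
      by (rule sym)
    then show ?thesis
      by (simp only: euclidean_representation)
  qed
  have f_eq: "?f = (\<lambda>z. exp ((\<Sum>v\<in>Basis. L v * of_real (z \<bullet> v)) - of_real (lam / 2 * (norm z)\<^sup>2)))"
  proof
    fix z
    have "cnj (bil (vcnj b) z) = bil b (vcnj z)"
      by (simp add: bil_def vcnj_def)
    then show "?f z = exp ((\<Sum>v\<in>Basis. L v * of_real (z \<bullet> v)) - of_real (lam / 2 * (norm z)\<^sup>2))"
      unfolding L_eq by (simp add: coherent_def L_def exp_cnj exp_of_real[symmetric]
          exp_add[symmetric] algebra_simps)
  qed
  \<comment> \<open>The two values are \<open>lam / 2\<close> times
    \<open>cnj (a $ k) + b $ k\<close> and \<open>lam / 2\<close> times
    \<open>\<i> * (cnj (a $ k) - b $ k)\<close>. In the sum of squares the pure squares cancel and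
    only the mixed term survives.\<close>
  have "(L (axis k 1))\<^sup>2 + (L (axis k \<i>))\<^sup>2 = of_real (lam\<^sup>2) * (cnj (a $ k) * b $ k)" for k
  proof -
    have "bil (vcnj a) (axis k u) = cnj (a $ k) * u" "bil b (vcnj (axis k u)) = b $ k * cnj u" for u
      by (simp_all add: bil_def vcnj_def axis_def if_distrib cong: if_cong)
    then show ?thesis
      by (simp add: L_def power2_eq_square algebra_simps)
  qed
  then have sum_eq: "(\<Sum>v\<in>Basis. (L v)\<^sup>2) = of_real (lam\<^sup>2) * bil (vcnj a) b"
    by (simp only: sum_Basis_complex_vec) (simp add: bil_def vcnj_def sum_distrib_left)
  let ?I = "of_real (sqrt (pi / (lam / 2)) ^ DIM(complex ^ 'n))
      * exp ((\<Sum>v\<in>Basis. (L v)\<^sup>2) / of_real (4 * (lam / 2)))"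
  have int: "has_bochner_integral lborel ?f ?I"
    unfolding f_eq by (rule has_bochner_integral_gaussian) (use assms in simp)
  \<comment> \<open>The real dimension is twice \<open>CARD('n)\<close>, so the square roots pair up
    and cancel \<open>C\<close> exactly.\<close>
  have "C * sqrt (pi / (lam / 2)) ^ DIM(complex ^ 'n) = (lam / (2 * pi) * (sqrt (2 * pi / lam))\<^sup>2) ^ CARD('n)"
    by (simp add: C_def power_divide power_mult_distrib power_mult[symmetric] mult.commute)
  also have "\<dots> = 1"
    using assms by simp
  finally have norm_eq: "C * sqrt (pi / (lam / 2)) ^ DIM(complex ^ 'n) = 1" .
  have "has_bochner_integral lborel (\<lambda>z. C *\<^sub>R ?f z) (C *\<^sub>R ?I)"
    using int by (rule has_bochner_integral_scaleR_right)
  also have "C *\<^sub>R ?I = exp (of_real lam * bil (vcnj a) b / 2)"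
  proof -
    have "(\<Sum>v\<in>Basis. (L v)\<^sup>2) / of_real (4 * (lam / 2)) = of_real lam * bil (vcnj a) b / 2"
      unfolding sum_eq using assms by (simp add: power2_eq_square)
    then show ?thesis
      by (simp only: scaleR_conv_of_real mult.assoc[symmetric] of_real_mult[symmetric] norm_eq) simp
  qed
  finally show ?thesis
    unfolding fock_measure_def C_def using assms int
    by (intro has_bochner_integral_density) (auto dest: borel_measurable_has_bochner_integral)
qed

lemma coherent_in_fock_space:
  assumes "lam > 0"
  shows "coherent lam a \<in> fock_space lam"
proof -
  have "integrable (fock_measure lam)
      (\<lambda>z. Re (coherent lam a z * cnj (coherent lam a z) * of_real (exp (- lam * (norm z)\<^sup>2 / 2))))"
    using has_bochner_integral_coherent[OF assms, of a a]
    by (intro integrable_Re) (simp add: has_bochner_integral_iff)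
  then show ?thesis
    by (simp add: fock_space_def entire_coherent complex_norm_square[symmetric]
        del: of_real_power)
qed

lemma fock_inner_coherent:
  assumes "lam > 0"
  shows "fock_inner lam (coherent lam a) (coherent lam b) = exp (of_real lam * bil (vcnj a) b / 2)"
  unfolding fock_inner_def
  by (rule has_bochner_integral_integral_eq[OF has_bochner_integral_coherent[OF assms]])

section \<open>Kernel and Berezin symbol\<close>

text \<open>The torus acts unitarily: conjugating the phase at \<open>t\<close> gives the phase at
  \<open>-t\<close>, by linearity of \<open>\<alpha> k\<close>. This moves the action from the
  argument of a coherent state to its label.\<close>

lemma bil_torus_act:
  assumes "\<And>k. linear (\<alpha> k)"
  shows "bil (vcnj w) (torus_act \<alpha> (- t) z) = bil (vcnj (torus_act \<alpha> t w)) z"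
  by (simp add: bil_def vcnj_def torus_act_def linear_neg[OF assms] exp_cnj mult_ac)

lemma bil_vcnj_add: "bil (vcnj (a + b)) z = bil (vcnj a) z + bil (vcnj b) z"
  by (simp add: bil_def vcnj_def distrib_right sum.distrib)

lemma bil_diff_right: "bil a (z - w) = bil a z - bil a w"
  by (simp add: bil_def right_diff_distrib sum_subtractf)

theorem proposition6p1:
  fixes lam :: real
    and \<alpha> :: "'n::finite \<Rightarrow> real ^ 'm::finite \<Rightarrow> real"
    and chi :: "real ^ 'm \<Rightarrow> complex"
    and t :: "real ^ 'm" and z0 :: "complex ^ 'n" and c0 :: real
  assumes "lam > 0"
    and "\<And>k. linear (\<alpha> k)"
    and "unitary_character chi"
    and "(t, z0, c0) \<in> carrier (diamond_group \<alpha>)"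
  shows "(\<forall>z w. op_kernel lam (fock_rep lam \<alpha> chi (t, z0, c0)) z w =
            chi t * exp (\<i> * of_real lam * of_real c0)
              * exp (of_real lam / 2 * bil (vcnj z0) z
                     + of_real lam / 2 * bil (vcnj w) (torus_act \<alpha> (- t) (z - z0))
                     - of_real lam / 4 * of_real ((norm z0)\<^sup>2)))
       \<and> (\<forall>z. berezin_symbol lam (fock_rep lam \<alpha> chi (t, z0, c0)) z =
            chi t * exp (\<i> * of_real lam * of_real c0)
              * exp (of_real lam / 2 * bil (vcnj z0) z
                     + of_real lam / 2 * bil (vcnj z) (torus_act \<alpha> (- t) (z - z0))
                     - of_real lam / 2 * of_real ((norm z)\<^sup>2)
                     - of_real lam / 4 * of_real ((norm z0)\<^sup>2)))"
proof -
  let ?A = "fock_rep lam \<alpha> chi (t, z0, c0)"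
  have kernel: "op_kernel lam ?A z w =
      chi t * exp (\<i> * of_real lam * of_real c0)
        * exp (of_real lam / 2 * bil (vcnj z0) z
               + of_real lam / 2 * bil (vcnj w) (torus_act \<alpha> (- t) (z - z0))
               - of_real lam / 4 * of_real ((norm z0)\<^sup>2))" for z w
  proof -
    \<comment> \<open>Moving the action onto \<open>w\<close> turns the exponent of the translated
      state into \<open>bil (vcnj (torus_act \<alpha> t w)) (v - z0)\<close>, up to the factor
      \<open>lam / 2\<close>. Its part in \<open>v\<close> joins the multiplier
      \<open>bil (vcnj z0) v\<close> to form the label \<open>u\<close>; its constant part goes into
      \<open>K\<close>.\<close>
    define u where "u = z0 + torus_act \<alpha> t w"
    define K where "K = chi t * exp (\<i> * of_real lam * of_real c0)
      * exp (- (of_real lam / 4 * of_real ((norm z0)\<^sup>2))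
             - of_real lam / 2 * bil (vcnj (torus_act \<alpha> t w)) z0)"
    have "?A (coherent lam w) = (\<lambda>v. K * coherent lam u v)"
    proof
      fix v
      \<comment> \<open>Membership in \<open>fock_space\<close> is needed to unfold
        \<open>fock_rep\<close>, which is \<open>undefined\<close> elsewhere.\<close>
      show "?A (coherent lam w) v = K * coherent lam u v"
        using coherent_in_fock_space[OF assms(1), of w]
        by (simp add: fock_rep_def coherent_def K_def u_def bil_torus_act[OF assms(2)]
            bil_vcnj_add bil_diff_right mult.assoc flip: exp_add)
          (simp add: add_divide_distrib diff_divide_distrib right_diff_distrib distrib_left,
           simp only: diff_conv_add_uminus add_ac simp_thms)
    qed
    then have "op_kernel lam ?A z w = K * fock_inner lam (coherent lam u) (coherent lam z)"
      by (simp add: op_kernel_def fock_inner_def mult.assoc)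
    then show ?thesis
      by (simp add: fock_inner_coherent[OF assms(1)] K_def u_def bil_torus_act[OF assms(2)]
            bil_vcnj_add bil_diff_right mult.assoc flip: exp_add)
          (simp add: add_divide_distrib diff_divide_distrib right_diff_distrib distrib_left,
           simp only: diff_conv_add_uminus add_ac simp_thms)
  qed
  have norm: "fock_inner lam (coherent lam z) (coherent lam z)
      = exp (of_real lam / 2 * of_real ((norm z)\<^sup>2))" for z :: "complex ^ 'n"
    using bil_vcnj_self[of z]
    by (simp add: fock_inner_coherent[OF assms(1)] bil_def mult.commute)
  \<comment> \<open>The symbol is the diagonal of the kernel divided by the squared norm of the
    coherent state, which accounts for the extra term in the exponent.\<close>
  have "berezin_symbol lam ?A z = op_kernel lam ?A z z / exp (of_real lam / 2 * of_real ((norm z)\<^sup>2))" for z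
    by (simp only: berezin_symbol_def op_kernel_def norm)
  then show ?thesis
    by (simp add: kernel exp_diff[symmetric] times_divide_eq_right[symmetric] algebra_simps
        del: times_divide_eq_right)
qed

end
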